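(* If $\mathfrak{R}$ is an expansion of $(\mathbb{R},<,\mathbb{N})$ such that every definable set is a union of maximal definably connected sets, then $\mathfrak{R}$ defines the divisibility relation $\{(n,dn) : n,d\in\mathbb{N}\}$ on $\mathbb{N}$.
   Context: $\mathbb{N}$ is the set of nonnegative integers. $\mathfrak{R}$ is a first-order structure with underlying set $\mathbb{R}$. "Definable" means definable in $\mathfrak{R}$ with parameters; definable sets are subsets of $\mathbb{R}^n$ for arbitrary $n$. Each $\mathbb{R}^n$ has its usual topology and subsets carry the subspace topology. A set $X\subseteq\mathbb{R}^n$ is definably connected (with respect to $\mathfrak{R}$) if it is definable and is not a union of two disjoint nonempty definable subsets of $X$ that are open in $X$. The hypothesis that a definable set $E$ "is a union of maximal definably connected sets" means that $E$ is the union of those definably connected subsets of $E$ that are maximal (with respect to inclusion) among the definably connected subsets of $E$. *)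

theory Defs
  imports "HOL-Analysis.Analysis"
begin

section \<open>First-order structures\<close>

datatype 'f trm = Var nat | Fun 'f "'f trm list"

datatype ('f, 'r) fm =
    Eq "'f trm" "'f trm"
  | Rel 'r "'f trm list"
  | Neg "('f, 'r) fm"
  | Conj "('f, 'r) fm" "('f, 'r) fm"
  | Exists nat "('f, 'r) fm"

text \<open>A symbol is a name together with an arity; the underlying set is all of \<open>UNIV :: 'a set\<close>.
  Only the values of \<open>fun_int f\<close> and \<open>rel_int r\<close> on lists whose length is the arity of a symbol
  of the signature are relevant.\<close>

record ('f, 'r, 'a) fo_structure =
  fun_syms :: "('f \<times> nat) set"
  rel_syms :: "('r \<times> nat) set"
  fun_int :: "'f \<Rightarrow> 'a list \<Rightarrow> 'a"
  rel_int :: "'r \<Rightarrow> 'a list \<Rightarrow> bool"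

fun wf_trm :: "('f, 'r, 'a) fo_structure \<Rightarrow> 'f trm \<Rightarrow> bool" where
  "wf_trm M (Var i) \<longleftrightarrow> True"
| "wf_trm M (Fun f ts) \<longleftrightarrow> (f, length ts) \<in> fun_syms M \<and> (\<forall>t\<in>set ts. wf_trm M t)"

fun wf_fm :: "('f, 'r, 'a) fo_structure \<Rightarrow> ('f, 'r) fm \<Rightarrow> bool" where
  "wf_fm M (Eq s t) \<longleftrightarrow> wf_trm M s \<and> wf_trm M t"
| "wf_fm M (Rel r ts) \<longleftrightarrow> (r, length ts) \<in> rel_syms M \<and> (\<forall>t\<in>set ts. wf_trm M t)"
| "wf_fm M (Neg \<phi>) \<longleftrightarrow> wf_fm M \<phi>"
| "wf_fm M (Conj \<phi> \<psi>) \<longleftrightarrow> wf_fm M \<phi> \<and> wf_fm M \<psi>"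
| "wf_fm M (Exists i \<phi>) \<longleftrightarrow> wf_fm M \<phi>"

fun eval_trm :: "('f, 'r, 'a) fo_structure \<Rightarrow> (nat \<Rightarrow> 'a) \<Rightarrow> 'f trm \<Rightarrow> 'a" where
  "eval_trm M e (Var i) = e i"
| "eval_trm M e (Fun f ts) = fun_int M f (map (eval_trm M e) ts)"

fun sat :: "('f, 'r, 'a) fo_structure \<Rightarrow> (nat \<Rightarrow> 'a) \<Rightarrow> ('f, 'r) fm \<Rightarrow> bool" where
  "sat M e (Eq s t) \<longleftrightarrow> eval_trm M e s = eval_trm M e t"
| "sat M e (Rel r ts) \<longleftrightarrow> rel_int M r (map (eval_trm M e) ts)"
| "sat M e (Neg \<phi>) \<longleftrightarrow> \<not> sat M e \<phi>"
| "sat M e (Conj \<phi> \<psi>) \<longleftrightarrow> sat M e \<phi> \<and> sat M e \<psi>"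
| "sat M e (Exists i \<phi>) \<longleftrightarrow> (\<exists>a. sat M (e(i := a)) \<phi>)"

section \<open>Structures on the real line\<close>

text \<open>\<open>Euclidean_space n\<close> realises \<open>\<real>\<^sup>n\<close> as the functions \<open>nat \<Rightarrow> real\<close> vanishing from index
  \<open>n\<close> on. In \<open>definable\<close>, the variables with index below \<open>n\<close> stand for the coordinates and the
  other free variables (finitely many) for the parameters, whose values are given by \<open>p\<close>.\<close>

definition definable :: "('f, 'r, real) fo_structure \<Rightarrow> nat \<Rightarrow> (nat \<Rightarrow> real) set \<Rightarrow> bool" where
  "definable M n X \<longleftrightarrow>
    (\<exists>\<phi> p. wf_fm M \<phi> \<and>
      X = {x \<in> topspace (Euclidean_space n). sat M (\<lambda>i. if i < n then x i else p i) \<phi>})"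

definition definably_connected ::
    "('f, 'r, real) fo_structure \<Rightarrow> nat \<Rightarrow> (nat \<Rightarrow> real) set \<Rightarrow> bool" where
  "definably_connected M n X \<longleftrightarrow>
    definable M n X \<and>
    \<not> (\<exists>U V. definable M n U \<and> definable M n V \<and>
          openin (subtopology (Euclidean_space n) X) U \<and>
          openin (subtopology (Euclidean_space n) X) V \<and>
          U \<noteq> {} \<and> V \<noteq> {} \<and> U \<inter> V = {} \<and> X = U \<union> V)"

definition maximal_definably_connected_subset ::
    "('f, 'r, real) fo_structure \<Rightarrow> nat \<Rightarrow> (nat \<Rightarrow> real) set \<Rightarrow> (nat \<Rightarrow> real) set \<Rightarrow> bool" where
  "maximal_definably_connected_subset M n E C \<longleftrightarrow>
    definably_connected M n C \<and> C \<subseteq> E \<and>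
    (\<forall>D. definably_connected M n D \<and> D \<subseteq> E \<and> C \<subseteq> D \<longrightarrow> D = C)"

definition union_of_maximal_definably_connected ::
    "('f, 'r, real) fo_structure \<Rightarrow> nat \<Rightarrow> (nat \<Rightarrow> real) set \<Rightarrow> bool" where
  "union_of_maximal_definably_connected M n E \<longleftrightarrow>
    E = \<Union> {C. maximal_definably_connected_subset M n E C}"

definition expands_less_Nats :: "('f, 'r, real) fo_structure \<Rightarrow> bool" where
  "expands_less_Nats M \<longleftrightarrow>
    (\<exists>l. (l, 2) \<in> rel_syms M \<and> (\<forall>x y. rel_int M l [x, y] \<longleftrightarrow> x < y)) \<and>
    (\<exists>k. (k, 1) \<in> rel_syms M \<and> (\<forall>x. rel_int M k [x] \<longleftrightarrow> x \<in> \<nat>))"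

definition point2 :: "real \<Rightarrow> real \<Rightarrow> nat \<Rightarrow> real" where
  "point2 a b = (\<lambda>i. if i = 0 then a else if i = 1 then b else 0)"

end

theory Submission
  imports Defs
begin

text \<open>For natural numbers \<open>n\<close> and \<open>m\<close> consider the finite graph on the pairs \<open>(i, x)\<close> with
  \<open>i \<le> n\<close> and \<open>x \<le> m\<close> whose edges join \<open>(i, x)\<close> to \<open>(i + 1, x + 1)\<close> and \<open>(n, x)\<close> to \<open>(0, x)\<close>.
  The residue of \<open>x - i\<close> modulo \<open>n\<close> is constant along edges, and \<open>(0, m)\<close> is reachable from \<open>(0, 0)\<close>
  iff \<open>n\<close> divides \<open>m\<close>. Since the edge relation is definable from \<open><\<close> and \<open>\<nat>\<close>, all these graphs
  can be drawn simultaneously as one definable subset of \<open>\<real>\<^sup>7\<close>, with all the vertices \<open>(0, 0)\<close>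
  connected to each other. Let \<open>C\<close> be a maximal definably connected subset containing them. It
  absorbs every definable connected piece it meets, hence everything reachable from \<open>(0, 0)\<close>.
  Conversely, the vertices of one fixed graph with \<open>n\<close> not dividing \<open>x - i\<close> form a finite set, so
  the part of the drawing over them is definable with parameters; it is clopen and misses \<open>(0, 0)\<close>,
  hence it misses \<open>C\<close>. So divisibility can be read off the definable set \<open>C\<close>.\<close>

section \<open>Definable predicates\<close>

abbreviation env_of :: "nat \<Rightarrow> (nat \<Rightarrow> real) \<Rightarrow> (nat \<Rightarrow> real) \<Rightarrow> nat \<Rightarrow> real" where
  "env_of n p x \<equiv> (\<lambda>i. if i < n then x i else p i)"

text \<open>Predicates in place of sets let definability be proved along the shape of a set
  comprehension. Only the values of \<open>P\<close> on points of the Euclidean space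
  matter.\<close>

definition definable_pred ::
    "('f, 'r, real) fo_structure \<Rightarrow> nat \<Rightarrow> ((nat \<Rightarrow> real) \<Rightarrow> bool) \<Rightarrow> bool" where
  "definable_pred M n P \<longleftrightarrow>
    (\<exists>\<phi> p. wf_fm M \<phi> \<and> (\<forall>x\<in>topspace (Euclidean_space n). P x \<longleftrightarrow> sat M (env_of n p x) \<phi>))"

lemma definable_predI:
  assumes "wf_fm M \<phi>" "\<And>x. x \<in> topspace (Euclidean_space n) \<Longrightarrow> P x \<longleftrightarrow> sat M (env_of n p x) \<phi>"
  shows "definable_pred M n P"
  using assms unfolding definable_pred_def by blast

lemma definable_pred_cong:
  assumes "definable_pred M n P" "\<And>x. x \<in> topspace (Euclidean_space n) \<Longrightarrow> P x \<longleftrightarrow> Q x"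
  shows "definable_pred M n Q"
  using assms unfolding definable_pred_def by blast

lemma definable_Collect_iff:
  "definable M n {x \<in> topspace (Euclidean_space n). P x} \<longleftrightarrow> definable_pred M n P"
  unfolding definable_def definable_pred_def set_eq_iff by fastforce

lemma definable_subset_topspace: "definable M n X \<Longrightarrow> X \<subseteq> topspace (Euclidean_space n)"
  unfolding definable_def by auto

lemma definable_iff_pred:
  "definable M n X \<longleftrightarrow> X \<subseteq> topspace (Euclidean_space n) \<and> definable_pred M n (\<lambda>x. x \<in> X)"
proof -
  have "{x \<in> topspace (Euclidean_space n). x \<in> X} = X" if "X \<subseteq> topspace (Euclidean_space n)"
    using that by auto
  then show ?thesis
    using definable_Collect_iff[of M n "\<lambda>x. x \<in> X"] definable_subset_topspace by metis
qed

section \<open>Renaming the variables of a formula\<close>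

primrec rename_trm :: "(nat \<Rightarrow> nat) \<Rightarrow> 'f trm \<Rightarrow> 'f trm" where
  "rename_trm f (Var i) = Var (f i)"
| "rename_trm f (Fun g ts) = Fun g (map (rename_trm f) ts)"

primrec rename_fm :: "(nat \<Rightarrow> nat) \<Rightarrow> ('f, 'r) fm \<Rightarrow> ('f, 'r) fm" where
  "rename_fm f (Eq s t) = Eq (rename_trm f s) (rename_trm f t)"
| "rename_fm f (Rel r ts) = Rel r (map (rename_trm f) ts)"
| "rename_fm f (Neg \<phi>) = Neg (rename_fm f \<phi>)"
| "rename_fm f (Conj \<phi> \<psi>) = Conj (rename_fm f \<phi>) (rename_fm f \<psi>)"
| "rename_fm f (Exists i \<phi>) = Exists (f i) (rename_fm f \<phi>)"

lemma wf_rename_trm [simp]: "wf_trm M (rename_trm f t) \<longleftrightarrow> wf_trm M t"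
  by (induction t) auto

lemma wf_rename_fm [simp]: "wf_fm M (rename_fm f \<phi>) \<longleftrightarrow> wf_fm M \<phi>"
  by (induction \<phi>) auto

lemma eval_rename_trm [simp]: "eval_trm M e (rename_trm f t) = eval_trm M (e \<circ> f) t"
  by (induction t) (auto simp: o_def cong: map_cong)

text \<open>Bound variables are renamed along with free ones. Injectivity of \<open>f\<close> rules
  out capture: updating \<open>e\<close> at \<open>f i\<close> changes \<open>e \<circ> f\<close> at
  index \<open>i\<close> only.\<close>

lemma sat_rename_fm:
  assumes "inj f"
  shows "sat M e (rename_fm f \<phi>) \<longleftrightarrow> sat M (e \<circ> f) \<phi>"
proof (induction \<phi> arbitrary: e)
  case (Exists i \<phi>)
  have "e(f i := a) \<circ> f = (e \<circ> f)(i := a)" for a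
    using assms by (auto simp: fun_eq_iff inj_eq)
  with Exists show ?case by (simp del: o_apply fun_upd_apply)
qed (auto simp: o_def)

section \<open>Closure under the logical operations\<close>

lemma definable_pred_not: "definable_pred M n P \<Longrightarrow> definable_pred M n (\<lambda>x. \<not> P x)"
  unfolding definable_pred_def by (metis sat.simps(3) wf_fm.simps(3))

lemma definable_pred_conj:
  assumes "definable_pred M n P" "definable_pred M n Q"
  shows "definable_pred M n (\<lambda>x. P x \<and> Q x)"
proof -
  obtain \<phi> p where 1: "wf_fm M \<phi>"
      "\<And>x. x \<in> topspace (Euclidean_space n) \<Longrightarrow> P x \<longleftrightarrow> sat M (env_of n p x) \<phi>"
    using assms(1) unfolding definable_pred_def by blast
  obtain \<psi> q where 2: "wf_fm M \<psi>"
      "\<And>x. x \<in> topspace (Euclidean_space n) \<Longrightarrow> Q x \<longleftrightarrow> sat M (env_of n q x) \<psi>"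
    using assms(2) unfolding definable_pred_def by blast
  \<comment> \<open>the parameters of the two formulas are made disjoint by interleaving them\<close>
  define f g r where "f = (\<lambda>i. if i < n then i else n + 2 * (i - n))"
    and "g = (\<lambda>i. if i < n then i else n + 2 * (i - n) + 1)"
    and "r = (\<lambda>i. if even (i - n) then p (n + (i - n) div 2) else q (n + (i - n) div 2))"
  have "inj f" "inj g"
    unfolding inj_def f_def g_def by (auto split: if_splits)
  moreover have "env_of n r x \<circ> f = env_of n p x" "env_of n r x \<circ> g = env_of n q x" for x
    by (auto simp: fun_eq_iff f_def g_def r_def)
  ultimately show ?thesis
    using 1 2
    by (intro definable_predI[of M "Conj (rename_fm f \<phi>) (rename_fm g \<psi>)" _ _ r])
       (simp_all add: sat_rename_fm)
qed

lemma definable_pred_disj: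
  assumes "definable_pred M n P" "definable_pred M n Q"
  shows "definable_pred M n (\<lambda>x. P x \<or> Q x)"
  using definable_pred_not[OF definable_pred_conj[OF assms[THEN definable_pred_not]]] by simp

text \<open>The last coordinate of the larger space becomes the bound variable \<open>n\<close>. The
  quantifier overwrites the value of \<open>p\<close> at \<open>n\<close>, so the same parameters
  serve for both formulas.\<close>

lemma definable_pred_ex:
  assumes "definable_pred M (Suc n) P"
  shows "definable_pred M n (\<lambda>x. \<exists>a. P (x(n := a)))"
proof -
  obtain \<phi> p where \<phi>: "wf_fm M \<phi>"
      "\<And>x. x \<in> topspace (Euclidean_space (Suc n)) \<Longrightarrow> P x \<longleftrightarrow> sat M (env_of (Suc n) p x) \<phi>"
    using assms unfolding definable_pred_def by blast
  have "P (x(n := a)) \<longleftrightarrow> sat M ((env_of n p x)(n := a)) \<phi>"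
    if "x \<in> topspace (Euclidean_space n)" for x a
  proof -
    have "env_of (Suc n) p (x(n := a)) = (env_of n p x)(n := a)"
      by (auto simp: fun_eq_iff)
    moreover have "x(n := a) \<in> topspace (Euclidean_space (Suc n))"
      using that by (auto simp: topspace_Euclidean_space)
    ultimately show ?thesis by (simp only: \<phi>(2))
  qed
  with \<phi>(1) show ?thesis
    by (intro definable_predI[of M "Exists n \<phi>" _ _ p]) (simp_all del: fun_upd_apply)
qed

lemma definable_pred_eq:
  assumes "i < n" "j < n"
  shows "definable_pred M n (\<lambda>x. x i = x j)"
  using assms by (intro definable_predI[of M "Eq (Var i) (Var j)"]) auto

lemma definable_pred_eq_const:
  assumes "i < n"
  shows "definable_pred M n (\<lambda>x. x i = c)"
  \<comment> \<open>Variable \<open>n\<close> is the first one beyond the coordinates, hence a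
    parameter; its value is set to \<open>c\<close>.\<close>
  using assms by (intro definable_predI[of M "Eq (Var i) (Var n)" _ _ "\<lambda>_. c"]) auto

lemma definable_pred_True: "definable_pred M n (\<lambda>x. True)"
  by (intro definable_predI[of M "Eq (Var 0) (Var 0)"]) auto

lemma definable_pred_False: "definable_pred M n (\<lambda>x. False)"
  using definable_pred_not[OF definable_pred_True] by simp

lemma definable_pred_finite_ex:
  assumes "finite B" "\<And>b. b \<in> B \<Longrightarrow> definable_pred M n (P b)"
  shows "definable_pred M n (\<lambda>x. \<exists>b\<in>B. P b x)"
  using assms by (induction rule: finite_induct) (auto intro: definable_pred_disj definable_pred_False)

lemma definable_pred_all_less:
  fixes m :: nat
  shows "(\<And>k. k < m \<Longrightarrow> definable_pred M n (P k)) \<Longrightarrow> definable_pred M n (\<lambda>x. \<forall>k<m. P k x)"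
  by (induction m) (auto simp: All_less_Suc intro: definable_pred_conj definable_pred_True)

lemma definable_Int:
  "definable M n X \<Longrightarrow> definable M n Y \<Longrightarrow> definable M n (X \<inter> Y)"
  unfolding definable_iff_pred by (auto intro: definable_pred_conj)

lemma definable_Un:
  "definable M n X \<Longrightarrow> definable M n Y \<Longrightarrow> definable M n (X \<union> Y)"
  unfolding definable_iff_pred by (auto intro: definable_pred_disj)

lemma definable_Diff:
  "definable M n X \<Longrightarrow> definable M n Y \<Longrightarrow> definable M n (X - Y)"
  unfolding definable_iff_pred by (auto intro: definable_pred_conj definable_pred_not)

section \<open>Relations definable from the order and the natural numbers\<close>

context
  fixes M :: "('f, 'r, real) fo_structure"
  assumes expands: "expands_less_Nats M"
begin

lemma definable_pred_less:
  assumes "i < n" "j < n"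
  shows "definable_pred M n (\<lambda>x. x i < x j)"
proof -
  obtain l where "(l, 2) \<in> rel_syms M" "\<And>x y. rel_int M l [x, y] \<longleftrightarrow> x < y"
    using expands unfolding expands_less_Nats_def by blast
  then show ?thesis
    using assms by (intro definable_predI[of M "Rel l [Var i, Var j]"]) (auto simp: numeral_2_eq_2)
qed

lemma definable_pred_le:
  assumes "i < n" "j < n"
  shows "definable_pred M n (\<lambda>x. x i \<le> x j)"
  using definable_pred_not[OF definable_pred_less[OF assms(2,1)]] by (simp add: not_less)

lemma definable_pred_le_const:
  assumes "i < n"
  shows "definable_pred M n (\<lambda>x. x i \<le> c)" "definable_pred M n (\<lambda>x. c \<le> x i)"
proof -
  \<comment> \<open>The constant enters as an auxiliary last coordinate equal to \<open>c\<close>,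
    which is then quantified away.\<close>
  have *: "definable_pred M (Suc n) (\<lambda>x. x n = c \<and> x i \<le> x n)"
     "definable_pred M (Suc n) (\<lambda>x. x n = c \<and> x n \<le> x i)"
    using assms by (auto intro!: definable_pred_conj definable_pred_eq_const definable_pred_le)
  show "definable_pred M n (\<lambda>x. x i \<le> c)" "definable_pred M n (\<lambda>x. c \<le> x i)"
    using *[THEN definable_pred_ex] assms by auto
qed

lemma definable_pred_Nats:
  assumes "i < n"
  shows "definable_pred M n (\<lambda>x. x i \<in> \<nat>)"
proof -
  obtain k where "(k, 1) \<in> rel_syms M" "\<And>x. rel_int M k [x] \<longleftrightarrow> x \<in> \<nat>"
    using expands unfolding expands_less_Nats_def by blast
  then show ?thesis
    using assms by (intro definable_predI[of M "Rel k [Var i]"]) auto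
qed

text \<open>Addition need not be available in the structure, so the successor of a natural number is
  described by the order: it is larger, with no natural number strictly between.\<close>

lemma definable_pred_succ:
  assumes "i < n" "j < n"
  shows "definable_pred M n (\<lambda>x. x i \<in> \<nat> \<and> x j \<in> \<nat> \<and> x j = x i + 1)"
proof (rule definable_pred_cong)
  have "definable_pred M (Suc n) (\<lambda>x. x n \<in> \<nat> \<and> x i < x n \<and> x n < x j)"
    using assms by (auto intro!: definable_pred_conj definable_pred_Nats definable_pred_less)
  from definable_pred_ex[OF this]
  have "definable_pred M n (\<lambda>x. \<exists>a. a \<in> \<nat> \<and> x i < a \<and> a < x j)"
    using assms by simp
  then show "definable_pred M n
      (\<lambda>x. x i \<in> \<nat> \<and> x j \<in> \<nat> \<and> x i < x j \<and> \<not> (\<exists>a. a \<in> \<nat> \<and> x i < a \<and> a < x j))"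
    using assms
    by (intro definable_pred_conj definable_pred_not definable_pred_Nats definable_pred_less)
next
  have "a < b \<and> \<not> (\<exists>c. c \<in> \<nat> \<and> a < c \<and> c < b) \<longleftrightarrow> b = a + 1"
    if ab: "a \<in> \<nat>" "b \<in> \<nat>" for a b :: real
  proof -
    obtain k l where [simp]: "a = real k" "b = real l" using ab by (auto elim!: Nats_cases)
    have "(\<exists>c. c \<in> \<nat> \<and> real k < c \<and> c < real l) \<longleftrightarrow> (\<exists>m. k < m \<and> m < l)"
      by (auto elim!: Nats_cases) (use of_nat_less_iff of_nat_in_Nats in blast)
    moreover have "real l = real k + 1 \<longleftrightarrow> l = Suc k" by linarith
    ultimately show ?thesis
      by simp (metis Suc_lessI lessI less_antisym not_less_eq)
  qed
  then show "x i \<in> \<nat> \<and> x j \<in> \<nat> \<and> x i < x j \<and> \<not> (\<exists>a. a \<in> \<nat> \<and> x i < a \<and> a < x j) \<longleftrightarrow>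
        x i \<in> \<nat> \<and> x j \<in> \<nat> \<and> x j = x i + 1" for x :: "nat \<Rightarrow> real"
    by blast
qed

end

section \<open>Definable connectedness\<close>

text \<open>This gives access to the type class notions of open, closed and connected sets on the
  function type.\<close>

lemma Euclidean_space_top_of_set: "Euclidean_space n = top_of_set {x. \<forall>i\<ge>n. x i = 0}"
  by (simp add: Euclidean_space_def euclidean_product_topology)

lemma subtopology_Euclidean_space:
  "X \<subseteq> topspace (Euclidean_space n) \<Longrightarrow> subtopology (Euclidean_space n) X = top_of_set X"
  by (simp add: Euclidean_space_top_of_set subtopology_subtopology Int_absorb1)

lemma definably_connected_iff:
  "definably_connected M n X \<longleftrightarrow> definable M n X \<and>
    (\<forall>U V. definable M n U \<and> definable M n V \<and> openin (top_of_set X) U \<and> openin (top_of_set X) V \<and>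
       U \<inter> V = {} \<and> X = U \<union> V \<longrightarrow> U = {} \<or> V = {})"
  using subtopology_Euclidean_space[OF definable_subset_topspace, of M n X]
  unfolding definably_connected_def by (smt (verit, best))

lemma definably_connectedI:
  assumes "definable M n X" "connected X"
  shows "definably_connected M n X"
  using assms unfolding definably_connected_iff connected_openin
  by (metis order_refl)

text \<open>Otherwise \<open>C \<inter> U\<close> and \<open>C - U\<close> would form a definable
  separation of \<open>C\<close>. Since only the trace on \<open>C\<close> has to be clopen,
  \<open>U\<close> can be given by a formula that does not mention \<open>C\<close>.\<close>

lemma definably_connected_clopen:
  assumes "definably_connected M n C" "definable M n U"
    "openin (top_of_set C) (C \<inter> U)" "closedin (top_of_set C) (C \<inter> U)"
  shows "C \<subseteq> U \<or> C \<inter> U = {}"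
proof -
  have "openin (top_of_set C) (C - U)"
    using assms(4) by (simp add: closedin_def Diff_Int)
  moreover have "definable M n C" using assms(1) by (simp add: definably_connected_iff)
  moreover have "(C \<inter> U) \<inter> (C - U) = {}" "C = (C \<inter> U) \<union> (C - U)" by auto
  ultimately have "C \<inter> U = {} \<or> C - U = {}"
    using assms definable_Int definable_Diff unfolding definably_connected_iff by metis
  then show ?thesis by auto
qed

text \<open>In a separation of the union, each of \<open>C\<close> and \<open>D\<close> lies on one
  side, and a common point puts both on the same side.\<close>

lemma definably_connected_Un:
  assumes C: "definably_connected M n C" and D: "definably_connected M n D" and "C \<inter> D \<noteq> {}"
  shows "definably_connected M n (C \<union> D)"
  unfolding definably_connected_iff
proof (intro conjI allI impI)
  show "definable M n (C \<union> D)"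
    using C D by (auto simp: definably_connected_iff intro: definable_Un)
  fix U V
  assume *: "definable M n U \<and> definable M n V \<and>
      openin (top_of_set (C \<union> D)) U \<and> openin (top_of_set (C \<union> D)) V \<and> U \<inter> V = {} \<and> C \<union> D = U \<union> V"
  have dich: "X \<subseteq> U \<or> X \<inter> U = {}" if X: "definably_connected M n X" "X \<subseteq> C \<union> D" for X
  proof (rule definably_connected_clopen[OF X(1)])
    have "openin (top_of_set X) (X \<inter> W)" if "openin (top_of_set (C \<union> D)) W" for W
    proof -
      from that have "\<exists>T. open T \<and> W = (C \<union> D) \<inter> T"
        by (simp only: openin_open)
      then obtain T where T: "open T" "W = (C \<union> D) \<inter> T"
        by (elim exE conjE)
      have "X \<inter> W = X \<inter> T"
        using X(2) unfolding T(2) by blast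
      with T(1) show ?thesis
        by (simp add: openin_open_Int)
    qed
    moreover have "X - (X \<inter> U) = X \<inter> V" using * X(2) by auto
    ultimately show "openin (top_of_set X) (X \<inter> U)" "closedin (top_of_set X) (X \<inter> U)"
      using * by (auto simp: closedin_def)
  qed (use * in auto)
  show "U = {} \<or> V = {}"
    using dich[OF C] dich[OF D] * \<open>C \<inter> D \<noteq> {}\<close> by blast
qed

text \<open>By the common point \<open>C \<union> D\<close> is again definably connected, so
  maximality makes it equal to \<open>C\<close>.\<close>

lemma maximal_definably_connected_absorbs:
  assumes "maximal_definably_connected_subset M n E C" "definably_connected M n D"
    "D \<subseteq> E" "C \<inter> D \<noteq> {}"
  shows "D \<subseteq> C"
  using definably_connected_Un[of M n C D] assms
  unfolding maximal_definably_connected_subset_def by (metis Un_subset_iff Un_upper1 Un_upper2)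

section \<open>Points and boxes given by lists\<close>

definition point_of :: "real list \<Rightarrow> nat \<Rightarrow> real" where
  "point_of xs = (\<lambda>k. if k < length xs then xs ! k else 0)"

text \<open>Padding with \<open>{0}\<close> keeps the box inside the Euclidean space and makes it a
  product over all indices, so the theorem on products of connected sets applies.\<close>

definition box_of :: "real set list \<Rightarrow> (nat \<Rightarrow> real) set" where
  "box_of Ss = {x. \<forall>k. x k \<in> (if k < length Ss then Ss ! k else {0})}"

lemma connected_box_of:
  assumes "\<forall>S\<in>set Ss. connected S"
  shows "connected (box_of Ss)"
proof -
  have "box_of Ss = PiE UNIV (\<lambda>k. if k < length Ss then Ss ! k else {0})"
    by (auto simp: box_of_def PiE_def Pi_def)
  moreover have "connectedin (powertop_real UNIV) \<dots>"
    using assms by (subst connectedin_PiE) auto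
  ultimately show ?thesis
    by (simp add: euclidean_product_topology)
qed

lemma box_of_eq:
  "box_of Ss = {x \<in> topspace (Euclidean_space (length Ss)). \<forall>k<length Ss. x k \<in> Ss ! k}"
proof -
  have "(\<forall>k. x k \<in> (if k < length Ss then Ss ! k else {0})) \<longleftrightarrow>
      (\<forall>k\<ge>length Ss. x k = 0) \<and> (\<forall>k<length Ss. x k \<in> Ss ! k)" for x :: "nat \<Rightarrow> real"
    by (metis not_less singleton_iff)
  then show ?thesis
    by (simp add: box_of_def topspace_Euclidean_space)
qed

lemma definable_box_of:
  assumes "\<And>k. k < length Ss \<Longrightarrow> definable_pred M (length Ss) (\<lambda>x. x k \<in> Ss ! k)"
  shows "definable M (length Ss) (box_of Ss)"
  unfolding box_of_eq definable_Collect_iff by (intro definable_pred_all_less assms)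

section \<open>A set whose components encode divisibility\<close>

definition vertex :: "real \<Rightarrow> real \<Rightarrow> real \<Rightarrow> real \<Rightarrow> bool" where
  "vertex n m i x \<longleftrightarrow> i \<in> \<nat> \<and> x \<in> \<nat> \<and> i \<le> n \<and> x \<le> m"

definition succ_Nats :: "real \<Rightarrow> real \<Rightarrow> bool" where
  "succ_Nats a b \<longleftrightarrow> a \<in> \<nat> \<and> b \<in> \<nat> \<and> b = a + 1"

text \<open>The loop at each vertex gives a vertical segment whose two ends carry the same vertex,
  so that a path can come back from level 1 to level 0.\<close>

definition edge :: "real \<Rightarrow> real \<Rightarrow> real \<Rightarrow> real \<Rightarrow> real \<Rightarrow> bool" where
  "edge n i x j y \<longleftrightarrow> i = j \<and> x = y \<or> succ_Nats i j \<and> succ_Nats x y \<or> i = n \<and> j = 0 \<and> x = y"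

text \<open>A point is \<open>(n, m, i, x, j, y, t)\<close>. The level \<open>t = 0\<close> contains a plane for every vertex
  \<open>(i, x)\<close>, the level \<open>t = 1\<close> a plane for every vertex \<open>(j, y)\<close>, and a vertical segment joins two
  such planes for every edge. The first disjunct is the hub joining the vertices \<open>(0, 0)\<close> of
  all the graphs.\<close>

definition graph_space :: "(nat \<Rightarrow> real) set" where
  "graph_space = {z \<in> topspace (Euclidean_space 7).
     z 2 = 0 \<and> z 3 = 0 \<and> z 4 = 0 \<and> z 5 = 0 \<and> z 6 = 0 \<or>
     z 0 \<in> \<nat> \<and> z 1 \<in> \<nat> \<and>
      (z 6 = 0 \<and> vertex (z 0) (z 1) (z 2) (z 3) \<or>
       z 6 = 1 \<and> vertex (z 0) (z 1) (z 4) (z 5) \<or>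
       0 \<le> z 6 \<and> z 6 \<le> 1 \<and> vertex (z 0) (z 1) (z 2) (z 3) \<and> vertex (z 0) (z 1) (z 4) (z 5) \<and>
         edge (z 0) (z 2) (z 3) (z 4) (z 5))}"

lemma definable_graph_space:
  assumes "expands_less_Nats M"
  shows "definable M 7 graph_space"
proof -
  have succ: "definable_pred M 7 (\<lambda>z. succ_Nats (z i) (z j))" if "i < 7" "j < 7" for i j
    using definable_pred_succ[OF assms that] by (simp add: succ_Nats_def)
  show ?thesis
    unfolding graph_space_def definable_Collect_iff vertex_def edge_def
    by (intro definable_pred_conj definable_pred_disj definable_pred_eq_const definable_pred_eq
         succ definable_pred_Nats[OF assms] definable_pred_le[OF assms]
         definable_pred_le_const[OF assms]) simp_all
qed

lemma graph_spaceI: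
  assumes "z \<in> topspace (Euclidean_space 7)" "z 0 \<in> \<nat>" "z 1 \<in> \<nat>"
  shows "z 6 = 0 \<Longrightarrow> vertex (z 0) (z 1) (z 2) (z 3) \<Longrightarrow> z \<in> graph_space"
    and "z 6 = 1 \<Longrightarrow> vertex (z 0) (z 1) (z 4) (z 5) \<Longrightarrow> z \<in> graph_space"
    and "z 6 \<in> {0..1} \<Longrightarrow> vertex (z 0) (z 1) (z 2) (z 3) \<Longrightarrow> vertex (z 0) (z 1) (z 4) (z 5) \<Longrightarrow>
      edge (z 0) (z 2) (z 3) (z 4) (z 5) \<Longrightarrow> z \<in> graph_space"
  using assms unfolding graph_space_def by simp_all

section \<open>Boxes in dimension seven\<close>

lemma all_less_7: "(\<forall>k<7. P k) \<longleftrightarrow> P 0 \<and> P 1 \<and> P 2 \<and> P 3 \<and> P 4 \<and> P 5 \<and> P (6::nat)"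
proof -
  have "k < 7 \<longleftrightarrow> k = 0 \<or> k = 1 \<or> k = 2 \<or> k = 3 \<or> k = 4 \<or> k = 5 \<or> k = 6" for k :: nat
    by linarith
  then show ?thesis by auto
qed

lemma mem_box_of_7:
  "z \<in> box_of [A, B, C, D, E, F, G] \<longleftrightarrow>
    z \<in> topspace (Euclidean_space 7) \<and>
    z 0 \<in> A \<and> z 1 \<in> B \<and> z 2 \<in> C \<and> z 3 \<in> D \<and> z 4 \<in> E \<and> z 5 \<in> F \<and> z 6 \<in> G"
proof -
  have 7: "length [A, B, C, D, E, F, G] = 7" by simp
  show ?thesis
    unfolding box_of_eq 7 all_less_7 by simp
qed

lemma point_of_7:
  "point_of [a, b, c, d, e, f, g] \<in> topspace (Euclidean_space 7)"
  "point_of [a, b, c, d, e, f, g] 0 = a" "point_of [a, b, c, d, e, f, g] (Suc 0) = b"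
  "point_of [a, b, c, d, e, f, g] 2 = c" "point_of [a, b, c, d, e, f, g] 3 = d"
  "point_of [a, b, c, d, e, f, g] 4 = e" "point_of [a, b, c, d, e, f, g] 5 = f"
  "point_of [a, b, c, d, e, f, g] 6 = g"
  by (simp_all add: point_of_def topspace_Euclidean_space)

text \<open>The three kinds of factors suffice for all planes and vertical segments of the drawing:
  a free coordinate, the range of the level, and a coordinate fixed by a parameter.\<close>

lemma definably_connected_box_7:
  assumes "expands_less_Nats M"
    and "\<forall>S \<in> {A, B, C, D, E, F, G}. S = UNIV \<or> S = {0..1} \<or> (\<exists>c. S = {c})"
  shows "definably_connected M 7 (box_of [A, B, C, D, E, F, G])"
proof (rule definably_connectedI)
  have *: "connected S \<and> definable_pred M 7 (\<lambda>x. x k \<in> S)"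
    if S: "S \<in> {A, B, C, D, E, F, G}" and k: "k < 7" for S k
  proof -
    consider "S = UNIV" | "S = {0..1}" | c where "S = {c}"
      using assms(2)[rule_format, OF S] by (elim disjE exE)
    then show ?thesis
    proof cases
      case 2
      then show ?thesis
        using k definable_pred_conj[OF definable_pred_le_const(2,1)[OF assms(1)], of k 7 k 0 1]
        by simp
    qed (use k in \<open>simp_all add: definable_pred_True definable_pred_eq_const\<close>)
  qed
  show "connected (box_of [A, B, C, D, E, F, G])"
    by (intro connected_box_of ballI conjunct1[OF *[of _ 0]]) simp_all
  have "\<forall>k<7. definable_pred M 7 (\<lambda>x. x k \<in> [A, B, C, D, E, F, G] ! k)"
    unfolding all_less_7 by (simp add: *)
  moreover have 7: "length [A, B, C, D, E, F, G] = 7" by simp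
  ultimately show "definable M 7 (box_of [A, B, C, D, E, F, G])"
    using definable_box_of[of "[A, B, C, D, E, F, G]" M] unfolding 7 by blast
qed

section \<open>The residue invariant and the clopen set it yields\<close>

lemma edge_dvd_iff:
  assumes "edge (real n) (real i) (real x) (real j) (real y)"
  shows "int n dvd int x - int i \<longleftrightarrow> int n dvd int y - int j"
proof -
  have "real j = real i + 1 \<longleftrightarrow> j = Suc i" "real y = real x + 1 \<longleftrightarrow> y = Suc x"
    by linarith+
  \<comment> \<open>Loops and diagonal edges keep the difference unchanged; the wrap-around edge
    changes it from \<open>x - n\<close> to \<open>x\<close>.\<close>
  with assms consider "i = j" "x = y" | "j = Suc i" "y = Suc x" | "i = n" "j = 0" "x = y"
    by (auto simp: edge_def succ_Nats_def)
  then show ?thesis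
  proof cases
    case 3
    have "int x = (int x - int n) + int n" by simp
    then show ?thesis using 3 by (metis diff_zero dvd_add_left_iff dvd_refl of_nat_0)
  qed auto
qed

text \<open>Distinct natural numbers are at distance at least 1. Hence equalities between them can
  be replaced by open conditions.\<close>

lemma Nats_near_eq:
  assumes "a \<in> \<nat>" "\<bar>a - real k\<bar> < 1/2"
  shows "a = real k"
proof -
  obtain l where "a = real l" using assms(1) by (auto elim: Nats_cases)
  moreover have "l = k"
  proof (rule linorder_cases[of l k])
    assume "l < k"
    then have "real l + 1 \<le> real k" by linarith
    with assms(2) \<open>a = real l\<close> show ?thesis by simp
  next
    assume "k < l"
    then have "real k + 1 \<le> real l" by linarith
    with assms(2) \<open>a = real l\<close> show ?thesis by simp
  qed
  ultimately show ?thesis by simp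
qed

lemma graph_space_sound:
  fixes n m :: nat
  assumes "expands_less_Nats M" and C: "definably_connected M 7 C" "C \<subseteq> graph_space"
    and origin: "point_of [0, 0, 0, 0, 0, 0, 0] \<in> C"
    and p: "point_of [real n, real m, 0, real m, 0, real m, 0] \<in> C"
  shows "n dvd m"
proof (rule ccontr)
  assume ndvd: "\<not> n dvd m"
  \<comment> \<open>These are the vertices outside the residue class of \<open>(0, 0)\<close>.
    Integers are used because \<open>x - i\<close> may be negative. Finiteness of \<open>B\<close>
    makes the sets below definable with parameters, and closed where needed.\<close>
  define B where "B = {(i, x). i \<le> n \<and> x \<le> m \<and> \<not> int n dvd int x - int i}"
  have "B \<subseteq> {..n} \<times> {..m}" by (auto simp: B_def)
  then have fin: "finite B" by (rule finite_subset) simp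
  define bad where "bad = (\<lambda>a b. \<exists>q\<in>B. a = real (fst q) \<and> b = real (snd q))"
  define near where "near = (\<lambda>a b. \<exists>q\<in>B. \<bar>a - real (fst q)\<bar> < 1/2 \<and> \<bar>b - real (snd q)\<bar> < 1/2)"
  \<comment> \<open>\<open>F\<close> is closed, \<open>G\<close> is open, and the two agree on
    \<open>graph_space\<close>, so their common trace on \<open>C\<close> is clopen. The last
    disjunct of \<open>F\<close> covers the interior of the vertical segments.\<close>
  define F where "F = {z :: nat \<Rightarrow> real. z 0 = real n \<and> z 1 = real m \<and>
    (z 6 \<le> 0 \<and> bad (z 2) (z 3) \<or> 1 \<le> z 6 \<and> bad (z 4) (z 5) \<or> bad (z 2) (z 3) \<and> bad (z 4) (z 5))}"
  \<comment> \<open>Off the hub, a point of \<open>graph_space\<close> with \<open>z 6 < 1\<close>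
    has a vertex as its first pair, and one with \<open>0 < z 6\<close> has a vertex as its second
    pair; \<open>near\<close> then determines that vertex.\<close>
  define G where "G = {z :: nat \<Rightarrow> real. \<bar>z 0 - real n\<bar> < 1/2 \<and> \<bar>z 1 - real m\<bar> < 1/2 \<and>
    (z 6 < 1 \<and> near (z 2) (z 3) \<or> 0 < z 6 \<and> near (z 4) (z 5))}"
  define U where "U = {z \<in> topspace (Euclidean_space 7). z \<in> F}"
  have bad_00: "\<not> bad 0 0"
    by (auto simp: bad_def B_def)
  have bad_near: "near a b" if "bad a b" for a b
    using that by (force simp: bad_def near_def)
  have near_bad: "bad a b" if "near a b" "a \<in> \<nat>" "b \<in> \<nat>" for a b
    using that Nats_near_eq unfolding bad_def near_def by blast
  have near_00: "\<not> near 0 0"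
    using near_bad bad_00 by auto
  have bad_edge: "bad i x \<longleftrightarrow> bad j y"
    if v: "vertex (real n) (real m) i x" "vertex (real n) (real m) j y" and e: "edge (real n) i x j y"
    for i x j y
  proof -
    obtain i' x' j' y' where [simp]: "i = real i'" "x = real x'" "j = real j'" "y = real y'"
      using v unfolding vertex_def by (elim conjE Nats_cases)
    show ?thesis
      using v e edge_dvd_iff[of n i' x' j' y'] by (auto simp: bad_def B_def vertex_def)
  qed

  have "closed F"
  proof -
    have "closed {z :: nat \<Rightarrow> real. bad (z k) (z l)}" for k l
    proof -
      have "closed (\<Union>q\<in>B. {z :: nat \<Rightarrow> real. z k = real (fst q) \<and> z l = real (snd q)})"
        by (intro closed_UN fin ballI closed_Collect_conj closed_Collect_eq continuous_intros
             continuous_on_product_coordinates)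
      moreover have "{z. bad (z k) (z l)} = (\<Union>q\<in>B. {z. z k = real (fst q) \<and> z l = real (snd q)})"
        unfolding bad_def by blast
      ultimately show ?thesis by simp
    qed
    then show ?thesis
      unfolding F_def
      by (intro closed_Collect_conj closed_Collect_disj closed_Collect_eq closed_Collect_le
           continuous_intros continuous_on_product_coordinates)
  qed
  have "open G"
    unfolding G_def near_def Bex_def
    by (intro open_Collect_conj open_Collect_disj open_Collect_ex open_Collect_less open_Collect_const
         continuous_intros continuous_on_product_coordinates)
  have "definable M 7 U"
    unfolding U_def F_def mem_Collect_eq definable_Collect_iff bad_def
    by (intro definable_pred_conj definable_pred_disj definable_pred_eq_const
         definable_pred_finite_ex[OF fin] definable_pred_le_const[OF assms(1)]) simp_all
  have CU: "C \<inter> U = C \<inter> F"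
    using C(2) by (auto simp: U_def graph_space_def)
  have "graph_space \<inter> F = graph_space \<inter> G"
  proof (intro equalityI subsetI IntI; elim IntE)
    fix z assume z: "z \<in> graph_space" "z \<in> F"
    then show "z \<in> G"
      using bad_near by (auto simp: F_def G_def)
  next
    fix z assume z: "z \<in> graph_space" "z \<in> G"
    have G: "\<bar>z 0 - real n\<bar> < 1/2" "\<bar>z 1 - real m\<bar> < 1/2"
        "z 6 < 1 \<and> near (z 2) (z 3) \<or> 0 < z 6 \<and> near (z 4) (z 5)"
      using z(2) by (auto simp: G_def)
    \<comment> \<open>Hub points are excluded because \<open>(0, 0)\<close> is not near a bad
      vertex. Off the hub \<open>z 0\<close> and \<open>z 1\<close> are natural numbers, so the open
      windows pin them to \<open>n\<close> and \<open>m\<close>.\<close>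
    then have not_hub: "\<not> (z 2 = 0 \<and> z 3 = 0 \<and> z 4 = 0 \<and> z 5 = 0)"
      using near_00 by auto
    with z(1) have "z 0 = real n" "z 1 = real m"
      using G(1,2) Nats_near_eq by (auto simp: graph_space_def)
    note nm = this
    consider "z 6 = 0" "vertex n m (z 2) (z 3)" | "z 6 = 1" "vertex n m (z 4) (z 5)"
      | "vertex n m (z 2) (z 3)" "vertex n m (z 4) (z 5)" "edge n (z 2) (z 3) (z 4) (z 5)"
      using z(1) not_hub unfolding graph_space_def mem_Collect_eq nm by blast
    then show "z \<in> F"
    proof cases
      case 1
      then show ?thesis using G(3) nm near_bad by (auto simp: F_def vertex_def)
    next
      case 2
      then show ?thesis using G(3) nm near_bad by (auto simp: F_def vertex_def)
    next
      case 3
      \<comment> \<open>Over an edge, one bad end forces the other to be bad, which gives the last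
        disjunct of \<open>F\<close> at every level.\<close>
      then have "bad (z 2) (z 3) \<or> bad (z 4) (z 5)"
        using G(3) near_bad by (auto simp: vertex_def)
      then show ?thesis
        using nm bad_edge[OF 3] by (simp add: F_def)
    qed
  qed
  then have CG: "C \<inter> F = C \<inter> G" using C(2) by blast
  have "C \<subseteq> U \<or> C \<inter> U = {}"
  proof (rule definably_connected_clopen[OF C(1) \<open>definable M 7 U\<close>])
    show "openin (top_of_set C) (C \<inter> U)"
      using \<open>open G\<close> by (simp add: CU CG openin_open_Int)
    show "closedin (top_of_set C) (C \<inter> U)"
      using \<open>closed F\<close> by (simp add: CU closedin_closed_Int)
  qed
  moreover have "point_of [0, 0, 0, 0, 0, 0, 0] \<notin> F"
    using bad_00 by (simp add: F_def point_of_def)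
  moreover have "point_of [real n, real m, 0, real m, 0, real m, 0] \<in> F"
    using ndvd by (auto simp: F_def point_of_def bad_def B_def)
  ultimately show False
    using origin p CU by blast
qed

section \<open>Absorbing everything reachable from the origin\<close>

lemma graph_space_complete:
  fixes n m :: nat
  assumes "expands_less_Nats M" and C: "maximal_definably_connected_subset M 7 graph_space C"
    and origin: "point_of [0, 0, 0, 0, 0, 0, 0] \<in> C"
    and "n dvd m"
  shows "point_of [real n, real m, 0, real m, 0, real m, 0] \<in> C"
proof -
  \<comment> \<open>A box inside \<open>graph_space\<close> that meets \<open>C\<close> is absorbed
    by \<open>C\<close>, so a path may travel freely within it.\<close>
  have move: "q \<in> C"
    if "p \<in> C" "p \<in> box_of Ss" "q \<in> box_of Ss" "box_of Ss \<subseteq> graph_space"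
      "Ss = [S0, S1, S2, S3, S4, S5, S6]"
      "\<forall>S \<in> {S0, S1, S2, S3, S4, S5, S6}. S = UNIV \<or> S = {0..1} \<or> (\<exists>c. S = {c})"
    for p q Ss S0 S1 S2 S3 S4 S5 S6
  proof -
    have "definably_connected M 7 (box_of Ss)"
      unfolding that(5) by (rule definably_connected_box_7[OF assms(1) that(6)])
    moreover have "C \<inter> box_of Ss \<noteq> {}"
      using that(1,2) by blast
    ultimately have "box_of Ss \<subseteq> C"
      using that(4) by (intro maximal_definably_connected_absorbs[OF C])
    with that(3) show ?thesis by (rule subsetD[rotated])
  qed
  \<comment> \<open>The hub leaves the first two coordinates free, which connects the origin to the
    vertex \<open>(0, 0)\<close> of the graph for \<open>n\<close> and \<open>m\<close>.\<close>
  have hub: "point_of [real n, real m, 0, 0, 0, 0, 0] \<in> C"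
    by (rule move[where Ss = "[UNIV, UNIV, {0}, {0}, {0}, {0}, {0}]", OF origin _ _ _ refl])
       (auto simp: point_of_7 mem_box_of_7 graph_space_def)
  \<comment> \<open>An edge is crossed in four moves: set the second pair to \<open>(j, y)\<close>
    at level 0, rise along the edge, set the first pair to \<open>(j, y)\<close> at level 1, descend
    along the loop at \<open>(j, y)\<close>.\<close>
  have step: "point_of [real n, real m, real j, real y, real j, real y, 0] \<in> C"
    if p: "point_of [real n, real m, real i, real x, real i, real x, 0] \<in> C"
      and v: "i \<le> n" "x \<le> m" "j \<le> n" "y \<le> m" and e: "edge (real n) (real i) (real x) (real j) (real y)"
    for i x j y
  proof -
    have ee: "edge (real n) (real j) (real y) (real j) (real y)" by (simp add: edge_def)
    have "point_of [real n, real m, real i, real x, real j, real y, 0] \<in> C"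
      by (rule move[where Ss = "[{real n}, {real m}, {real i}, {real x}, UNIV, UNIV, {0}]", OF p _ _ _ refl])
         (use v in \<open>auto simp: point_of_7 mem_box_of_7 vertex_def intro!: graph_spaceI(1)\<close>)
    then have "point_of [real n, real m, real i, real x, real j, real y, 1] \<in> C"
      by (rule move[where Ss = "[{real n}, {real m}, {real i}, {real x}, {real j}, {real y}, {0..1}]", OF _ _ _ _ refl])
         (use v e in \<open>auto simp: point_of_7 mem_box_of_7 vertex_def intro!: graph_spaceI(3)\<close>)
    then have "point_of [real n, real m, real j, real y, real j, real y, 1] \<in> C"
      by (rule move[where Ss = "[{real n}, {real m}, UNIV, UNIV, {real j}, {real y}, {1}]", OF _ _ _ _ refl])
         (use v in \<open>auto simp: point_of_7 mem_box_of_7 vertex_def intro!: graph_spaceI(2)\<close>)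
    then show ?thesis
      by (rule move[where Ss = "[{real n}, {real m}, {real j}, {real y}, {real j}, {real y}, {0..1}]", OF _ _ _ _ refl])
         (use v ee in \<open>auto simp: point_of_7 mem_box_of_7 vertex_def intro!: graph_spaceI(3)\<close>)
  qed
  have climb: "point_of [real n, real m, real i, real (x + i), real i, real (x + i), 0] \<in> C"
    if "point_of [real n, real m, 0, real x, 0, real x, 0] \<in> C" "i \<le> n" "x + i \<le> m" for x i
    using that(2,3)
  proof (induction i)
    case 0
    then show ?case using that(1) by simp
  next
    case (Suc i)
    have "edge (real n) (real i) (real (x + i)) (real (Suc i)) (real (x + Suc i))"
      by (simp add: edge_def succ_Nats_def)
    with Suc show ?case
      by (intro step[of i "x + i" "Suc i" "x + Suc i"]) simp_all
  qed
  \<comment> \<open>Each lap climbs \<open>n\<close> diagonal edges from \<open>(0, d * n)\<close>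
    to \<open>(n, Suc d * n)\<close> and then wraps around to \<open>(0, Suc d * n)\<close>.\<close>
  have "point_of [real n, real m, 0, real (d * n), 0, real (d * n), 0] \<in> C" if "d * n \<le> m" for d
    using that
  proof (induction d)
    case 0
    then show ?case using hub by simp
  next
    case (Suc d)
    then have "point_of [real n, real m, real n, real (Suc d * n), real n, real (Suc d * n), 0] \<in> C"
      using climb[of "d * n" n] by (simp add: add.commute)
    then have "point_of [real n, real m, real 0, real (Suc d * n), real 0, real (Suc d * n), 0] \<in> C"
      by (rule step) (use Suc.prems in \<open>auto simp: edge_def\<close>)
    then show ?case by simp
  qed
  moreover obtain d where "m = d * n" using \<open>n dvd m\<close> by (metis dvdE mult.commute)
  ultimately show ?thesis by simp
qed

section \<open>Reading divisibility off the maximal set\<close>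

theorem mainTheorem11:
  fixes M :: "('f, 'r, real) fo_structure"
  assumes "expands_less_Nats M"
    and "\<And>n E. definable M n E \<Longrightarrow> union_of_maximal_definably_connected M n E"
  shows "definable M 2 {point2 (real n) (real (d * n)) | n d :: nat. True}"
proof -
  have "point_of [0, 0, 0, 0, 0, 0, 0] \<in> graph_space"
    by (auto simp: graph_space_def point_of_def topspace_Euclidean_space)
  moreover have "union_of_maximal_definably_connected M 7 graph_space"
    using assms definable_graph_space by blast
  ultimately obtain C where C: "maximal_definably_connected_subset M 7 graph_space C"
      and origin: "point_of [0, 0, 0, 0, 0, 0, 0] \<in> C"
    unfolding union_of_maximal_definably_connected_def by blast
  have dc: "definably_connected M 7 C" "C \<subseteq> graph_space"
    using C by (auto simp: maximal_definably_connected_subset_def)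
  have dvd_iff: "point_of [real n, real m, 0, real m, 0, real m, 0] \<in> C \<longleftrightarrow> n dvd m" for n m
    using graph_space_sound[OF assms(1) dc origin] graph_space_complete[OF assms(1) C origin] by blast
  \<comment> \<open>The last five coordinates are determined by the first two, so quantifying them
    away amounts to substituting these values.\<close>
  define P where "P = (\<lambda>z. z 0 \<in> \<nat> \<and> z 1 \<in> \<nat> \<and> z 2 = 0 \<and> z 3 = z 1 \<and> z 4 = 0 \<and> z 5 = z 1 \<and> z 6 = 0 \<and> z \<in> C)"
  have "definable_pred M 7 (\<lambda>z. z \<in> C)"
    using dc(1) by (simp add: definably_connected_iff definable_iff_pred)
  then have "definable_pred M 7 P"
    unfolding P_def
    by (intro definable_pred_conj definable_pred_Nats[OF assms(1)] definable_pred_eq_const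
         definable_pred_eq) simp_all
  \<comment> \<open>Writing 7 as five successors of 2 allows five projections, each removing the
    last coordinate.\<close>
  then have "definable_pred M (Suc (Suc (Suc (Suc (Suc 2))))) P" by simp
  from this[THEN definable_pred_ex, THEN definable_pred_ex, THEN definable_pred_ex,
      THEN definable_pred_ex, THEN definable_pred_ex]
  have "definable_pred M 2 (\<lambda>z. \<exists>a b c d e. P (z(2 := a, 3 := b, 4 := c, 5 := d, 6 := e)))"
    by (simp del: fun_upd_apply)
  then have "definable_pred M 2 (\<lambda>z. z 0 \<in> \<nat> \<and> z 1 \<in> \<nat> \<and> z(2 := 0, 3 := z 1, 4 := 0, 5 := z 1, 6 := 0) \<in> C)"
    by (simp add: P_def)
  moreover have "{point2 (real n) (real (d * n)) | n d. True} =
    {z \<in> topspace (Euclidean_space 2). z 0 \<in> \<nat> \<and> z 1 \<in> \<nat> \<and> z(2 := 0, 3 := z 1, 4 := 0, 5 := z 1, 6 := 0) \<in> C}"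
    (is "_ = {z \<in> _. ?Q z}")
  proof -
    have Q: "?Q (point2 a b) \<longleftrightarrow> (\<exists>n d. a = real n \<and> b = real (d * n))" for a b
    proof -
      have "(point2 a b)(2 := 0, 3 := b, 4 := 0, 5 := b, 6 := 0) = point_of [a, b, 0, b, 0, b, 0]"
      proof
        fix k :: nat
        consider "k < 7" | "k \<ge> 7" by linarith
        then show "((point2 a b)(2 := 0, 3 := b, 4 := 0, 5 := b, 6 := 0)) k =
            point_of [a, b, 0, b, 0, b, 0] k"
        proof cases
          case 1
          moreover have "\<forall>k<7. ((point2 a b)(2 := 0, 3 := b, 4 := 0, 5 := b, 6 := 0)) k =
              point_of [a, b, 0, b, 0, b, 0] k"
            unfolding all_less_7 by (simp add: point2_def point_of_def)
          ultimately show ?thesis by blast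
        qed (auto simp: point2_def point_of_def)
      qed
      then have "?Q (point2 a b) \<longleftrightarrow> a \<in> \<nat> \<and> b \<in> \<nat> \<and> point_of [a, b, 0, b, 0, b, 0] \<in> C"
        by (simp add: point2_def)
      also have "\<dots> \<longleftrightarrow> (\<exists>n m. a = real n \<and> b = real m \<and> n dvd m)"
        using dvd_iff by (auto elim!: Nats_cases)
      also have "\<dots> \<longleftrightarrow> (\<exists>n d. a = real n \<and> b = real (d * n))"
        by (metis dvd_triv_right dvdE mult.commute)
      finally show ?thesis
        by (simp only:)
    qed
    have "z = point2 (z 0) (z 1)" if "z \<in> topspace (Euclidean_space 2)" for z
      using that by (auto simp: point2_def topspace_Euclidean_space fun_eq_iff)
    moreover have "point2 a b \<in> topspace (Euclidean_space 2)" for a b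
      by (auto simp: point2_def topspace_Euclidean_space)
    ultimately show ?thesis
      using Q by (smt (verit) Collect_cong)
  qed
  ultimately show ?thesis
    by (simp only: definable_Collect_iff)
qed

end
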